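(* Let $\mathbb{K}$ be a commutative unital ring, let $Q$ be a quiver with vertex set $V$, and let $e\in\mathbb{K}Q$. Then $e$ is left special if and only if there exist (1) a left closed subset $S\subseteq V$, (2) an $S$-indexed family $\{\lambda_v\}_{v\in S}$ of non-zero idempotents of $\mathbb{K}$ such that $\mathbb{K}\lambda_v\subseteq\mathbb{K}\lambda_{v'}$ whenever there is a path $p$ with $s(p)=v$ and $t(p)=v'$ (with $v\in S$), (3) a collection of distinct paths $p_1,\ldots,p_n$ with $t(p_i)\in S$ for all $i\in\{1,\ldots,n\}$, (4) a collection of non-zero elements $\kappa_1,\ldots,\kappa_n$ of $\mathbb{K}$ with $\lambda_{t(p_i)}\kappa_i=\kappa_i$ for all $i\in\{1,\ldots,n\}$, and $\lambda_{s(p_i)}\kappa_i=0$ for all $i\in\{1,\ldots,n\}$ with $s(p_i)\in S$, such that $e=\sum_{v\in S}\lambda_ve_v+\sum_{i=1}^n\kappa_ip_i$.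
   Context: A quiver $Q=(V,E,s,t)$ consists of (possibly infinite) sets $V$ (vertices), $E$ (edges) and functions $s,t:E\to V$ (source, target). A path is either a finite non-empty sequence of edges $a_1,\ldots,a_n$ with $t(a_i)=s(a_{i+1})$, written $a_n\cdots a_1$ (with source $s(a_1)$ and target $t(a_n)$), or a trivial path $e_v$, $v\in V$ (with source and target $v$). The path algebra $\mathbb{K}Q$ is the free $\mathbb{K}$-module on the set of paths, with bilinear multiplication: $pq=0$ if $t(q)\neq s(p)$; $pq$ is the concatenation ($q$ first, then $p$) if $p,q$ are non-trivial and $t(q)=s(p)$; $e_{t(p)}p=pe_{s(p)}=p$. A subset $S\subseteq V$ is left closed if it is finite and whenever $v\in S$ and $a$ is an edge with $s(a)=v$, then $t(a)\in S$. The algebra $A=\mathbb{K}Q$ is idempotented: every finite set of elements $a_1,\dots,a_n\in A$ admits an idempotent $f$ with $fa_i=a_if=a_i$ for all $i$. A left $A$-module $M$ is non-degenerate if for every $m\in M$ there is an idempotent $f\in A$ with $fm=m$; $\mathsf{M}(A)$ is the category of non-degenerate left $A$-modules. An element $e\in A$ is left special if it is idempotent and the full subcategory $\{M\in\mathsf{M}(A)\mid M=AeM\}$ of $\mathsf{M}(A)$ is closed under subquotients, where $AeM$ is the $A$-submodule of $M$ generated by $eM$. *)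

theory Defs
  imports
    "HOL-Algebra.Module"
    "HOL-Library.Poly_Mapping"
    "Graph_Theory.Arc_Walk"
begin

text \<open>
  A quiver is a \<^locale>\<open>wf_digraph\<close>: a directed multigraph with arbitrary (possibly empty or
  infinite) sets of vertices and arcs; \<^const>\<open>tail\<close> is the source map and \<^const>\<open>head\<close> the
  target map.

  A path is a pair of its source and the list of its arcs, in the order in which they are
  traversed: \<open>(s a\<^sub>1, [a\<^sub>1, \<dots>, a\<^sub>n])\<close> is the path written \<open>a\<^sub>n \<cdots> a\<^sub>1\<close>, and \<open>(v, [])\<close> is the
  trivial path at \<open>v\<close>.
\<close>

type_synonym ('v, 'e) path = "'v \<times> 'e list"

definition paths :: "('v, 'e) pre_digraph \<Rightarrow> ('v, 'e) path set" where
  "paths Q = {(u, as). \<exists>v. pre_digraph.awalk Q u as v}"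

definition path_source :: "('v, 'e) path \<Rightarrow> 'v" where
  "path_source p = fst p"

definition path_target :: "('v, 'e) pre_digraph \<Rightarrow> ('v, 'e) path \<Rightarrow> 'v" where
  "path_target Q p = pre_digraph.awlast Q (fst p) (snd p)"

definition trivial_path :: "'v \<Rightarrow> ('v, 'e) path" where
  "trivial_path v = (v, [])"

text \<open>The concatenation \<open>p q\<close>, in which \<open>q\<close> is traversed first.\<close>

definition path_comp :: "('v, 'e) path \<Rightarrow> ('v, 'e) path \<Rightarrow> ('v, 'e) path" where
  "path_comp p q = (path_source q, snd q @ snd p)"

text \<open>
  The coefficients form a type of sort \<open>{comm_ring, comm_monoid_mult}\<close>, that is, a commutative
  unital ring in which \<open>0 = 1\<close> is not excluded (as it would be by \<^class>\<open>comm_ring_1\<close>).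
  The free module on the paths consists of the finitely supported functions on paths.
\<close>

type_synonym ('v, 'e, 'k) path_vec = "('v, 'e) path \<Rightarrow>\<^sub>0 'k"

definition path_algebra ::
    "('v, 'e) pre_digraph \<Rightarrow> ('v, 'e, 'k::{comm_ring, comm_monoid_mult}) path_vec set" where
  "path_algebra Q = {a. Poly_Mapping.keys a \<subseteq> paths Q}"

definition pa_scale ::
    "'k::{comm_ring, comm_monoid_mult} \<Rightarrow> ('v, 'e, 'k) path_vec \<Rightarrow> ('v, 'e, 'k) path_vec" where
  "pa_scale k a = Poly_Mapping.map ((*) k) a"

definition pa_mult ::
    "('v, 'e) pre_digraph \<Rightarrow> ('v, 'e, 'k::{comm_ring, comm_monoid_mult}) path_vec \<Rightarrow>
      ('v, 'e, 'k) path_vec \<Rightarrow> ('v, 'e, 'k) path_vec" where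
  "pa_mult Q a b =
    (\<Sum>p\<in>Poly_Mapping.keys a. \<Sum>q\<in>Poly_Mapping.keys b.
       if path_target Q q = path_source p
       then Poly_Mapping.single (path_comp p q)
              (Poly_Mapping.lookup a p * Poly_Mapping.lookup b q)
       else 0)"

definition pa_idempotent ::
    "('v, 'e) pre_digraph \<Rightarrow> ('v, 'e, 'k::{comm_ring, comm_monoid_mult}) path_vec \<Rightarrow> bool" where
  "pa_idempotent Q f \<longleftrightarrow> f \<in> path_algebra Q \<and> pa_mult Q f f = f"

definition left_closed :: "('v, 'e) pre_digraph \<Rightarrow> 'v set \<Rightarrow> bool" where
  "left_closed Q S \<longleftrightarrow>
    S \<subseteq> verts Q \<and> finite S \<and> (\<forall>a\<in>arcs Q. tail Q a \<in> S \<longrightarrow> head Q a \<in> S)"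

text \<open>The type class operations on the coefficients as a record, for use with
  \<^locale>\<open>Module.module\<close>.\<close>

definition scalar_ring :: "'k::{comm_ring, comm_monoid_mult} ring" where
  "scalar_ring = \<lparr>carrier = UNIV, mult = (*), one = 1, zero = 0, add = (+)\<rparr>"

lemma cring_scalar_ring: "cring (scalar_ring :: 'k::{comm_ring, comm_monoid_mult} ring)"
proof (rule cringI)
  show "abelian_group (scalar_ring :: 'k ring)"
  proof (rule abelian_groupI)
    fix x :: 'k
    have "- x + x = 0" by simp
    then show "\<exists>y\<in>carrier scalar_ring. y \<oplus>\<^bsub>scalar_ring\<^esub> x = \<zero>\<^bsub>scalar_ring\<^esub>"
      unfolding scalar_ring_def by (metis UNIV_I partial_object.select_convs(1) ring.simps(1,2))
  qed (auto simp: scalar_ring_def algebra_simps)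
  show "comm_monoid (scalar_ring :: 'k ring)"
    by (rule comm_monoidI) (auto simp: scalar_ring_def algebra_simps)
qed (auto simp: scalar_ring_def algebra_simps)

text \<open>
  A left module over the algebra \<open>A = KQ\<close> is a \<open>K\<close>-module with a \<open>K\<close>-bilinear associative
  action of \<open>A\<close>.  (The fields \<^const>\<open>mult\<close> and \<^const>\<open>one\<close> of the record are unused, as
  in \<^locale>\<open>Module.module\<close>.)
\<close>

record ('k, 'm, 'a) alg_module = "('k, 'm) module" +
  act :: "'a \<Rightarrow> 'm \<Rightarrow> 'm"

locale path_algebra_module = Module.module scalar_ring M
  for Q :: "('v, 'e) pre_digraph"
    and M :: "('k::{comm_ring, comm_monoid_mult}, 'm, ('v, 'e, 'k) path_vec) alg_module"
      (structure) +
  assumes act_closed: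
      "\<lbrakk>a \<in> path_algebra Q; x \<in> carrier M\<rbrakk> \<Longrightarrow> act M a x \<in> carrier M"
    and act_add_left:
      "\<lbrakk>a \<in> path_algebra Q; b \<in> path_algebra Q; x \<in> carrier M\<rbrakk> \<Longrightarrow>
        act M (a + b) x = act M a x \<oplus>\<^bsub>M\<^esub> act M b x"
    and act_add_right:
      "\<lbrakk>a \<in> path_algebra Q; x \<in> carrier M; y \<in> carrier M\<rbrakk> \<Longrightarrow>
        act M a (x \<oplus>\<^bsub>M\<^esub> y) = act M a x \<oplus>\<^bsub>M\<^esub> act M a y"
    and act_scale_left:
      "\<lbrakk>a \<in> path_algebra Q; x \<in> carrier M\<rbrakk> \<Longrightarrow>
        act M (pa_scale k a) x = k \<odot>\<^bsub>M\<^esub> act M a x"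
    and act_scale_right:
      "\<lbrakk>a \<in> path_algebra Q; x \<in> carrier M\<rbrakk> \<Longrightarrow>
        act M a (k \<odot>\<^bsub>M\<^esub> x) = k \<odot>\<^bsub>M\<^esub> act M a x"
    and act_mult:
      "\<lbrakk>a \<in> path_algebra Q; b \<in> path_algebra Q; x \<in> carrier M\<rbrakk> \<Longrightarrow>
        act M (pa_mult Q a b) x = act M a (act M b x)"

definition nondegenerate ::
    "('v, 'e) pre_digraph \<Rightarrow>
      ('k::{comm_ring, comm_monoid_mult}, 'm, ('v, 'e, 'k) path_vec) alg_module \<Rightarrow> bool" where
  "nondegenerate Q M \<longleftrightarrow>
    path_algebra_module Q M \<and> (\<forall>m\<in>carrier M. \<exists>f. pa_idempotent Q f \<and> act M f m = m)"

definition alg_submodule ::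
    "('v, 'e) pre_digraph \<Rightarrow>
      ('k::{comm_ring, comm_monoid_mult}, 'm, ('v, 'e, 'k) path_vec) alg_module \<Rightarrow>
      'm set \<Rightarrow> bool" where
  "alg_submodule Q M L \<longleftrightarrow>
    submodule L scalar_ring M \<and> (\<forall>a\<in>path_algebra Q. \<forall>x\<in>L. act M a x \<in> L)"

text \<open>The submodule \<open>AeM\<close> generated by \<open>eM\<close>.\<close>

definition gen_submodule ::
    "('v, 'e) pre_digraph \<Rightarrow> ('v, 'e, 'k) path_vec \<Rightarrow>
      ('k::{comm_ring, comm_monoid_mult}, 'm, ('v, 'e, 'k) path_vec) alg_module \<Rightarrow> 'm set" where
  "gen_submodule Q e M = \<Inter>{L. alg_submodule Q M L \<and> act M e ` carrier M \<subseteq> L}"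

text \<open>\<open>N\<close> is, up to isomorphism, a subquotient of \<open>M\<close>: a homomorphic image of a submodule.\<close>

definition subquotient ::
    "('v, 'e) pre_digraph \<Rightarrow>
      ('k::{comm_ring, comm_monoid_mult}, 'm, ('v, 'e, 'k) path_vec) alg_module \<Rightarrow>
      ('k, 'm, ('v, 'e, 'k) path_vec) alg_module \<Rightarrow> bool" where
  "subquotient Q N M \<longleftrightarrow>
    (\<exists>L h. alg_submodule Q M L \<and> h ` L = carrier N \<and>
      (\<forall>x\<in>L. \<forall>y\<in>L. h (x \<oplus>\<^bsub>M\<^esub> y) = h x \<oplus>\<^bsub>N\<^esub> h y) \<and>
      (\<forall>k. \<forall>x\<in>L. h (k \<odot>\<^bsub>M\<^esub> x) = k \<odot>\<^bsub>N\<^esub> h x) \<and>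
      (\<forall>a\<in>path_algebra Q. \<forall>x\<in>L. h (act M a x) = act N a (h x)))"

text \<open>
  Being left special refers to all non-degenerate modules.  As HOL cannot quantify over types
  inside a formula, the type \<open>'m\<close> that contains the underlying sets of the modules is a
  parameter, which plays the role of a universe.  It has to be large enough: if it has room for
  all finite sequences of elements of \<open>A = KQ\<close>, then it contains a copy of every finitely
  generated module, and these suffice to detect a failure of closure under subquotients.
\<close>

definition left_special ::
    "'m itself \<Rightarrow> ('v, 'e) pre_digraph \<Rightarrow>
      ('v, 'e, 'k::{comm_ring, comm_monoid_mult}) path_vec \<Rightarrow> bool" where
  "left_special (_ :: 'm itself) Q e \<longleftrightarrow>
    pa_idempotent Q e \<and>
    (\<forall>(M :: ('k, 'm, ('v, 'e, 'k) path_vec) alg_module)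
      (N :: ('k, 'm, ('v, 'e, 'k) path_vec) alg_module).
      nondegenerate Q M \<and> carrier M = gen_submodule Q e M \<and>
      nondegenerate Q N \<and> subquotient Q N M \<longrightarrow>
      carrier N = gen_submodule Q e N)"

end

theory Submission
  imports Defs
begin

text \<open>
  Write $\lambda_v$ for the coefficient of $e$ at the trivial path $e_v$ and $u = \sum_v \lambda_v e_v$.
  The explicit form of $e$ amounts to $\lambda_{s(q)} \lambda_{t(q)} = \lambda_{s(q)}$ for all paths
  $q$, $\lambda_{t(p)} \kappa_p = \kappa_p$ for every coefficient $\kappa_p$ of $e$, and
  $\lambda_{s(p)} \kappa_p = 0$ if $p$ is non-trivial.

  Under these conditions $ue = e$ and $eu = u$, and $au = uau$ for all $a \in A$.  Hence $u$ acts as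
  the identity on $AeM = AuM$, so that $M = AeM$ just says that $u$ acts as the identity on $M$, which
  passes to subquotients.

  Conversely, if $e$ is left special then no nonzero subquotient of $Ae$ is annihilated by $e$.  For
  the submodule $B$ of the elements of $Ae$ in degrees $\geq m$ and its quotient by those elements
  whose degree $m$ part is fixed by $u$, this yields that $u$ fixes the degree $m$ part of every
  element of $B$.  The first condition is the case of $qe$ with $q$ of length $m$, and the second the
  case of $ue - e = (u - e)e$ with $p$ a shortest path violating it.  The third condition follows
  from $e^2 = e$ by induction on the length of $p$.
\<close>

section \<open>Coefficients and membership in the path algebra\<close>

abbreviation coeff :: "('v, 'e, 'k::{comm_ring, comm_monoid_mult}) path_vec \<Rightarrow> ('v, 'e) path \<Rightarrow> 'k"
  where "coeff \<equiv> Poly_Mapping.lookup"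

lemma coeff_pa_scale [simp]: "coeff (pa_scale k a) p = k * coeff a p"
  by (auto simp: pa_scale_def Poly_Mapping.map.rep_eq when_def)

lemma path_algebra_iff: "a \<in> path_algebra Q \<longleftrightarrow> (\<forall>p. p \<notin> paths Q \<longrightarrow> coeff a p = 0)"
  by (auto simp: path_algebra_def in_keys_iff)

lemma path_algebra_add: "a \<in> path_algebra Q \<Longrightarrow> b \<in> path_algebra Q \<Longrightarrow> a + b \<in> path_algebra Q"
  by (auto simp: path_algebra_iff lookup_add)

lemma path_algebra_scale: "a \<in> path_algebra Q \<Longrightarrow> pa_scale k a \<in> path_algebra Q"
  by (auto simp: path_algebra_iff)

section \<open>Submodules of modules over the path algebra\<close>

context path_algebra_module
begin

lemma act_zero [simp]:
  assumes "a \<in> path_algebra Q"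
  shows "act M a \<zero>\<^bsub>M\<^esub> = \<zero>\<^bsub>M\<^esub>"
  using act_add_right[OF assms M.zero_closed M.zero_closed] act_closed[OF assms M.zero_closed]
  by (simp add: M.add.r_cancel_one')

text \<open>Closure under negatives comes from the scalars, as a negative is a multiple by
  -1.\<close>

lemma alg_submoduleI:
  assumes "X \<subseteq> carrier M" "\<zero>\<^bsub>M\<^esub> \<in> X"
    and "\<And>x y. \<lbrakk>x \<in> X; y \<in> X\<rbrakk> \<Longrightarrow> x \<oplus>\<^bsub>M\<^esub> y \<in> X"
    and smult: "\<And>(k :: 'k) x. x \<in> X \<Longrightarrow> k \<odot>\<^bsub>M\<^esub> x \<in> X"
    and "\<And>a x. \<lbrakk>a \<in> path_algebra Q; x \<in> X\<rbrakk> \<Longrightarrow> act M a x \<in> X"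
  shows "alg_submodule Q M X"
proof -
  have "\<ominus>\<^bsub>M\<^esub> x \<in> X" if "x \<in> X" for x
    using that smult assms(1) smult_l_minus[OF R.one_closed, of x] by (metis smult_one subsetD)
  then show ?thesis
    using assms by (auto simp: alg_submodule_def intro!: submoduleI)
qed

text \<open>The whole carrier is a submodule containing \<open>eM\<close>, hence one of the sets
  intersected.\<close>

lemma gen_submodule_subset:
  assumes "e \<in> path_algebra Q"
  shows "gen_submodule Q e M \<subseteq> carrier M"
  unfolding gen_submodule_def
  using assms act_closed
  by (intro Inter_lower CollectI conjI alg_submoduleI) (auto simp: scalar_ring_def intro: smult_closed)

lemma alg_submodule_zero: "alg_submodule Q M {\<zero>\<^bsub>M\<^esub>}"
  by (rule alg_submoduleI) (auto simp: scalar_ring_def intro: smult_r_null)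

end

section \<open>Endpoints and splittings of paths\<close>

locale quiver = wf_digraph Q for Q :: "('v, 'e) pre_digraph"
begin

lemma awlast_Nil [simp]: "awlast u [] = u"
  by (simp add: awalk_verts.simps)

lemma awlast_Cons [simp]: "awlast u (a # as) = awlast (head Q a) as"
  by (cases as) (auto simp: awalk_verts.simps)

lemma awlast_append [simp]: "awlast u (as @ bs) = awlast (awlast u as) bs"
  by (induction as arbitrary: u) auto

lemma awlast_take_take:
  "awlast (awlast u (take i as)) (take j (drop i as)) = awlast u (take (i + j) as)"
  by (simp add: take_add)

lemma paths_iff: "(u, as) \<in> paths Q \<longleftrightarrow> awalk u as (awlast u as)"
  by (auto simp: paths_def)

lemma trivial_path_in_paths_iff [simp]: "(v, []) \<in> paths Q \<longleftrightarrow> v \<in> verts Q"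
  by (auto simp: paths_iff awalk_Nil_iff)

lemma paths_append_iff:
  "(u, as @ bs) \<in> paths Q \<longleftrightarrow> (u, as) \<in> paths Q \<and> (awlast u as, bs) \<in> paths Q"
  by (auto simp: paths_iff)

lemma paths_target_in_verts: "(u, as) \<in> paths Q \<Longrightarrow> awlast u as \<in> verts Q"
  by (auto simp: paths_iff)

section \<open>Multiplication in the path algebra\<close>

text \<open>A factorisation of \<open>(v, as)\<close> is a choice of cut position \<open>i\<close>,
  the length of the factor traversed first; the cuts at both ends are included. Extending the sum to
  pairs outside the supports adds only zeros.\<close>

lemma coeff_pa_mult:
  fixes a b :: "('v, 'e, 'k::{comm_ring, comm_monoid_mult}) path_vec"
  shows "coeff (pa_mult Q a b) (v, as) =
    (\<Sum>i\<le>length as. coeff a (awlast v (take i as), drop i as) * coeff b (v, take i as))"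
proof -
  define split where "split i = ((awlast v (take i as), drop i as), (v, take i as))" for i
  define D where "D = split ` {..length as}"
  have inj: "inj_on split {..length as}"
    by (rule inj_onI) (metis Pair_inject atMost_iff length_take min.absorb2 split_def)
  have D: "(p, q) \<in> D \<longleftrightarrow> path_target Q q = path_source p \<and> path_comp p q = (v, as)" for p q
  proof
    assume "path_target Q q = path_source p \<and> path_comp p q = (v, as)"
    then have "(p, q) = split (length (snd q))" "length (snd q) \<le> length as"
      by (auto simp: split_def path_target_def path_source_def path_comp_def prod_eq_iff)
    then show "(p, q) \<in> D" by (auto simp: D_def)
  qed (auto simp: D_def split_def path_target_def path_source_def path_comp_def)
  let ?f = "\<lambda>(p, q). coeff a p * coeff b q"
  have "coeff (pa_mult Q a b) (v, as) =
      (\<Sum>p\<in>Poly_Mapping.keys a. \<Sum>q\<in>Poly_Mapping.keys b. if (p, q) \<in> D then ?f (p, q) else 0)"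
    unfolding pa_mult_def lookup_sum
    by (intro sum.cong refl) (auto simp: D lookup_single when_def)
  also have "\<dots> = (\<Sum>x\<in>Poly_Mapping.keys a \<times> Poly_Mapping.keys b. if x \<in> D then ?f x else 0)"
    unfolding sum.cartesian_product by (intro sum.cong) auto
  also have "\<dots> = (\<Sum>x\<in>Poly_Mapping.keys a \<times> Poly_Mapping.keys b \<inter> D. ?f x)"
    by (rule sum.inter_restrict[symmetric]) simp
  also have "\<dots> = sum ?f D"
    by (rule sum.mono_neutral_left) (auto simp: D_def in_keys_iff)
  also have "\<dots> = (\<Sum>i\<le>length as. ?f (split i))"
    unfolding D_def by (subst sum.reindex[OF inj]) simp
  finally show ?thesis by (simp add: split_def)
qed

text \<open>Both sides sum over two cuts \<open>i \<le> j\<close> of \<open>as\<close> into three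
  pieces, carried by \<open>c\<close>, \<open>b\<close> and \<open>a\<close> in the order of
  traversal. On the left the second cut is first counted from \<open>i\<close>.\<close>

lemma pa_mult_assoc:
  fixes a b c :: "('v, 'e, 'k::{comm_ring, comm_monoid_mult}) path_vec"
  shows "pa_mult Q (pa_mult Q a b) c = pa_mult Q a (pa_mult Q b c)"
proof (rule poly_mapping_eqI)
  fix p :: "('v, 'e) path"
  obtain v as where p: "p = (v, as)" by (cases p)
  let ?n = "length as"
  let ?f = "\<lambda>i j. coeff a (awlast v (take j as), drop j as) *
    (coeff b (awlast v (take i as), drop i (take j as)) * coeff c (v, take i as))"
  have "coeff (pa_mult Q (pa_mult Q a b) c) p = (\<Sum>i\<le>?n. \<Sum>j\<le>?n - i. ?f i (i + j))"
    unfolding p coeff_pa_mult sum_distrib_right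
    by (intro sum.cong refl)
      (auto simp: mult.assoc awlast_take_take drop_take add.commute)
  also have "\<dots> = (\<Sum>i\<le>?n. \<Sum>j\<in>{i..?n}. ?f i j)"
  proof (rule sum.cong[OF refl])
    fix i assume "i \<in> {..?n}"
    then show "(\<Sum>j\<le>?n - i. ?f i (i + j)) = (\<Sum>j\<in>{i..?n}. ?f i j)"
      by (intro sum.reindex_bij_witness[of _ "\<lambda>j. j - i" "\<lambda>j. i + j"]) auto
  qed
  also have "\<dots> = (\<Sum>j\<le>?n. \<Sum>i\<le>j. ?f i j)"
    unfolding sum.Sigma[OF finite_atMost ballI[OF finite_atLeastAtMost]]
      sum.Sigma[OF finite_atMost ballI[OF finite_atMost]]
    by (intro sum.reindex_bij_witness[of _ prod.swap prod.swap]) auto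
  also have "\<dots> = coeff (pa_mult Q a (pa_mult Q b c)) p"
    unfolding p coeff_pa_mult sum_distrib_left
    by (intro sum.cong) (auto simp: min.absorb1 min.absorb2)
  finally show "coeff (pa_mult Q (pa_mult Q a b) c) p = coeff (pa_mult Q a (pa_mult Q b c)) p" .
qed

lemma pa_mult_add_left: "pa_mult Q (a + b) c = pa_mult Q a c + pa_mult Q b c"
proof (rule poly_mapping_eqI)
  show "coeff (pa_mult Q (a + b) c) p = coeff (pa_mult Q a c + pa_mult Q b c) p" for p
    by (cases p) (simp add: coeff_pa_mult lookup_add distrib_right sum.distrib)
qed

lemma pa_mult_add_right: "pa_mult Q a (b + c) = pa_mult Q a b + pa_mult Q a c"
proof (rule poly_mapping_eqI)
  show "coeff (pa_mult Q a (b + c)) p = coeff (pa_mult Q a b + pa_mult Q a c) p" for p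
    by (cases p) (simp add: coeff_pa_mult lookup_add distrib_left sum.distrib)
qed

lemma pa_mult_scale_left: "pa_mult Q (pa_scale k a) b = pa_scale k (pa_mult Q a b)"
proof (rule poly_mapping_eqI)
  show "coeff (pa_mult Q (pa_scale k a) b) p = coeff (pa_scale k (pa_mult Q a b)) p" for p
    by (cases p) (simp add: coeff_pa_mult sum_distrib_left mult.assoc)
qed

lemma pa_mult_scale_right: "pa_mult Q a (pa_scale k b) = pa_scale k (pa_mult Q a b)"
proof (rule poly_mapping_eqI)
  show "coeff (pa_mult Q a (pa_scale k b)) p = coeff (pa_scale k (pa_mult Q a b)) p" for p
    by (cases p) (simp add: coeff_pa_mult sum_distrib_left mult.left_commute)
qed

text \<open>If \<open>(v, as)\<close> is not a path, then at every cut one of the two pieces is not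
  a path either.\<close>

lemma pa_mult_closed:
  fixes a b :: "('v, 'e, 'k::{comm_ring, comm_monoid_mult}) path_vec"
  assumes "a \<in> path_algebra Q" "b \<in> path_algebra Q"
  shows "pa_mult Q a b \<in> path_algebra Q"
  unfolding path_algebra_iff
proof (intro allI impI)
  fix p :: "('v, 'e) path"
  assume p: "p \<notin> paths Q"
  obtain v as where vas: "p = (v, as)" by (cases p)
  have "coeff a (awlast v (take i as), drop i as) * coeff b (v, take i as) = 0" for i
    using p assms paths_append_iff[of v "take i as" "drop i as"]
    unfolding vas path_algebra_iff append_take_drop_id by (metis mult_zero_left mult_zero_right)
  then show "coeff (pa_mult Q a b) p = 0"
    by (simp add: vas coeff_pa_mult)
qed

section \<open>Diagonal elements and local units\<close>

text \<open>A predicate rather than a function of \<open>l\<close>, because the combination of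
  trivial paths with coefficients \<open>l v\<close> exists only for finitely supported
  \<open>l\<close>.\<close>

definition diag :: "('v \<Rightarrow> 'k) \<Rightarrow> ('v, 'e, 'k::{comm_ring, comm_monoid_mult}) path_vec \<Rightarrow> bool" where
  "diag l u \<longleftrightarrow> (\<forall>v as. coeff u (v, as) = (if as = [] then l v else 0))"

text \<open>Only the cut at the end of \<open>as\<close> leaves a trivial piece for
  \<open>u\<close>, so \<open>l\<close> is evaluated at the target. For multiplication on the right
  it is the cut at the start, and the source.\<close>

lemma coeff_diag_mult_left:
  fixes u a :: "('v, 'e, 'k::{comm_ring, comm_monoid_mult}) path_vec"
  assumes "diag l u"
  shows "coeff (pa_mult Q u a) (v, as) = l (awlast v as) * coeff a (v, as)"
proof -
  have "coeff (pa_mult Q u a) (v, as) =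
      (\<Sum>i\<le>length as. if i = length as then l (awlast v as) * coeff a (v, as) else 0)"
    unfolding coeff_pa_mult using assms by (intro sum.cong) (auto simp: diag_def)
  then show ?thesis by simp
qed

lemma coeff_diag_mult_right:
  fixes u a :: "('v, 'e, 'k::{comm_ring, comm_monoid_mult}) path_vec"
  assumes "diag l u"
  shows "coeff (pa_mult Q a u) (v, as) = coeff a (v, as) * l v"
proof -
  have "coeff (pa_mult Q a u) (v, as) =
      (\<Sum>i\<le>length as. if i = 0 then coeff a (v, as) * l v else 0)"
    unfolding coeff_pa_mult using assms by (intro sum.cong) (auto simp: diag_def)
  then show ?thesis by simp
qed

lemma ex_diag:
  assumes "finite {v. l v \<noteq> 0}" "{v. l v \<noteq> 0} \<subseteq> verts Q"
  shows "\<exists>u\<in>path_algebra Q. diag l u"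
proof -
  let ?u = "\<Sum>v | l v \<noteq> 0. Poly_Mapping.single (v, []) (l v)"
  have "coeff ?u (v, as) = (if as = [] then l v else 0)" for v and as :: "'e list"
    using assms(1) by (auto simp: lookup_sum lookup_single when_def cong: if_cong)
  then have "diag l ?u" by (simp add: diag_def del: split_paired_All)
  moreover from this have "?u \<in> path_algebra Q"
    using assms(2) unfolding path_algebra_iff diag_def by auto
  ultimately show ?thesis by blast
qed

text \<open>The sum of the trivial paths at the targets of the support of \<open>x\<close> serves.
  This makes every quotient of left ideals non-degenerate.\<close>

lemma ex_local_unit:
  fixes x :: "('v, 'e, 'k::{comm_ring, comm_monoid_mult}) path_vec"
  assumes "x \<in> path_algebra Q"
  shows "\<exists>f. pa_idempotent Q f \<and> pa_mult Q f x = x"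
proof -
  define T where "T = path_target Q ` Poly_Mapping.keys x"
  define l :: "'v \<Rightarrow> 'k" where "l v = (if v \<in> T then 1 else 0)" for v
  have "T \<subseteq> verts Q"
    using assms paths_target_in_verts
    by (force simp: T_def path_algebra_def path_target_def)
  \<comment> \<open>Only an inclusion, since the coefficient ring may satisfy 0 = 1.\<close>
  moreover have "{v. l v \<noteq> 0} \<subseteq> T" "finite T"
    by (auto simp: l_def T_def)
  ultimately obtain f where f: "f \<in> path_algebra Q" "diag l f"
    using ex_diag[of l] by (meson finite_subset subset_trans)
  have "coeff (pa_mult Q f f) p = coeff f p" "coeff (pa_mult Q f x) p = coeff x p" for p
    using f(2) by (cases p; force simp: coeff_diag_mult_left[OF f(2)] diag_def l_def T_def
        path_target_def in_keys_iff)+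
  then show ?thesis
    using f(1) unfolding pa_idempotent_def by (metis poly_mapping_eqI)
qed

section \<open>Left ideals and their quotient modules\<close>

definition left_ideal :: "('v, 'e, 'k::{comm_ring, comm_monoid_mult}) path_vec set \<Rightarrow> bool" where
  "left_ideal B \<longleftrightarrow> B \<subseteq> path_algebra Q \<and> 0 \<in> B \<and> (\<forall>x\<in>B. \<forall>y\<in>B. x + y \<in> B) \<and>
    (\<forall>k. \<forall>x\<in>B. pa_scale k x \<in> B) \<and> (\<forall>a\<in>path_algebra Q. \<forall>x\<in>B. pa_mult Q a x \<in> B)"

lemma left_ideal_diff:
  assumes "left_ideal B" "x \<in> B" "y \<in> B"
  shows "x - y \<in> B"
proof -
  have "x - y = x + pa_scale (- 1) y"
    by (rule poly_mapping_eqI) (simp add: lookup_add lookup_minus)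
  then show ?thesis using assms unfolding left_ideal_def by metis
qed

lemma left_ideal_zero: "left_ideal {0 :: ('v, 'e, 'k::{comm_ring, comm_monoid_mult}) path_vec}"
proof -
  have "pa_scale k (0 :: ('v, 'e, 'k) path_vec) = 0" for k
    by (rule poly_mapping_eqI) simp
  moreover have "pa_mult Q a 0 = 0" for a :: "('v, 'e, 'k) path_vec"
    by (simp add: pa_mult_def)
  ultimately show ?thesis by (simp add: left_ideal_def path_algebra_def)
qed

lemma left_ideal_principal:
  fixes e :: "('v, 'e, 'k::{comm_ring, comm_monoid_mult}) path_vec"
  assumes "e \<in> path_algebra Q"
  shows "left_ideal ((\<lambda>a. pa_mult Q a e) ` path_algebra Q)"
  unfolding left_ideal_def
proof (intro conjI ballI allI)
  have "0 \<in> path_algebra Q" "pa_mult Q 0 e = 0"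
    by (auto simp: path_algebra_def pa_mult_def)
  then show "0 \<in> (\<lambda>a. pa_mult Q a e) ` path_algebra Q"
    by force
  show "x + y \<in> (\<lambda>a. pa_mult Q a e) ` path_algebra Q"
    if "x \<in> (\<lambda>a. pa_mult Q a e) ` path_algebra Q" "y \<in> (\<lambda>a. pa_mult Q a e) ` path_algebra Q" for x y
    using that by (auto simp: pa_mult_add_left[symmetric] intro!: imageI path_algebra_add)
  show "pa_scale k x \<in> (\<lambda>a. pa_mult Q a e) ` path_algebra Q"
    if "x \<in> (\<lambda>a. pa_mult Q a e) ` path_algebra Q" for k x
    using that by (auto simp: pa_mult_scale_left[symmetric] intro!: imageI path_algebra_scale)
qed (use assms in \<open>auto simp: pa_mult_assoc[symmetric] intro!: imageI pa_mult_closed\<close>)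

text \<open>\<^term>\<open>g\<close> induces an isomorphism of \<open>B / L\<close> onto \<^term>\<open>M\<close>.\<close>

definition quotient_map ::
    "('k::{comm_ring, comm_monoid_mult}, 'm, ('v, 'e, 'k) path_vec) alg_module \<Rightarrow>
      (('v, 'e, 'k) path_vec \<Rightarrow> 'm) \<Rightarrow>
      ('v, 'e, 'k) path_vec set \<Rightarrow> ('v, 'e, 'k) path_vec set \<Rightarrow> bool" where
  "quotient_map M g B L \<longleftrightarrow>
    nondegenerate Q M \<and> carrier M = g ` B \<and>
    (\<forall>x\<in>B. \<forall>y\<in>B. g x = g y \<longleftrightarrow> x - y \<in> L) \<and>
    \<zero>\<^bsub>M\<^esub> = g 0 \<and>
    (\<forall>x\<in>B. \<forall>y\<in>B. g x \<oplus>\<^bsub>M\<^esub> g y = g (x + y)) \<and>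
    (\<forall>k. \<forall>x\<in>B. k \<odot>\<^bsub>M\<^esub> g x = g (pa_scale k x)) \<and>
    (\<forall>a\<in>path_algebra Q. \<forall>x\<in>B. act M a (g x) = g (pa_mult Q a x))"

lemma quotient_mapD:
  assumes "quotient_map M g B L"
  shows "nondegenerate Q M" "carrier M = g ` B"
    "\<And>x y. \<lbrakk>x \<in> B; y \<in> B\<rbrakk> \<Longrightarrow> g x = g y \<longleftrightarrow> x - y \<in> L"
    "\<zero>\<^bsub>M\<^esub> = g 0"
    "\<And>x y. \<lbrakk>x \<in> B; y \<in> B\<rbrakk> \<Longrightarrow> g x \<oplus>\<^bsub>M\<^esub> g y = g (x + y)"
    "\<And>k x. x \<in> B \<Longrightarrow> k \<odot>\<^bsub>M\<^esub> g x = g (pa_scale k x)"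
    "\<And>a x. \<lbrakk>a \<in> path_algebra Q; x \<in> B\<rbrakk> \<Longrightarrow> act M a (g x) = g (pa_mult Q a x)"
  using assms unfolding quotient_map_def by blast+

text \<open>Each coset of \<open>L\<close> in \<open>B\<close> is encoded by a chosen
  representative, which \<open>emb\<close> carries into the type \<open>'m\<close>. The operations
  are computed on preimages and are well defined modulo \<open>L\<close>.\<close>

lemma ex_quotient_map:
  fixes B L :: "('v, 'e, 'k::{comm_ring, comm_monoid_mult}) path_vec set"
    and emb :: "('v, 'e, 'k) path_vec \<Rightarrow> 'm"
  assumes B: "left_ideal B" and L: "left_ideal L" and "L \<subseteq> B" and emb: "inj_on emb (path_algebra Q)"
  shows "\<exists>(M :: ('k, 'm, ('v, 'e, 'k) path_vec) alg_module) g. quotient_map M g B L"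
proof -
  have B_closed: "0 \<in> B" "x \<in> B \<Longrightarrow> y \<in> B \<Longrightarrow> x + y \<in> B" "x \<in> B \<Longrightarrow> pa_scale k x \<in> B"
    "a \<in> path_algebra Q \<Longrightarrow> x \<in> B \<Longrightarrow> pa_mult Q a x \<in> B" "x \<in> B \<Longrightarrow> x \<in> path_algebra Q" for x y a k
    using B by (auto simp: left_ideal_def)
  define rep where "rep x = (SOME y. y \<in> B \<and> x - y \<in> L)" for x
  define g where "g x = emb (rep x)" for x
  have rep: "rep x \<in> B \<and> x - rep x \<in> L" if "x \<in> B" for x
    unfolding rep_def by (rule someI[of _ x]) (use that L in \<open>auto simp: left_ideal_def\<close>)
  have g_eq: "g x = g y \<longleftrightarrow> x - y \<in> L" if xy: "x \<in> B" "y \<in> B" for x y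
  proof
    assume "g x = g y"
    then have "rep x = rep y"
      unfolding g_def using emb rep xy B_closed(5) by (meson inj_onD)
    then have "x - y = (x - rep x) - (y - rep y)" by simp
    then show "x - y \<in> L" using left_ideal_diff[OF L] rep xy by metis
  next
    assume *: "x - y \<in> L"
    \<comment> \<open>Congruent elements satisfy the same predicate in the definition of
      \<open>rep\<close>, so the choice operator returns the same representative for both.\<close>
    have "x - z \<in> L \<longleftrightarrow> y - z \<in> L" for z
    proof
      assume "x - z \<in> L"
      from left_ideal_diff[OF L this *] show "y - z \<in> L" by simp
    next
      assume "y - z \<in> L"
      moreover have "x - z = (x - y) + (y - z)" by simp
      ultimately show "x - z \<in> L" using L * by (metis left_ideal_def)
    qed
    then show "g x = g y" by (simp add: g_def rep_def)
  qed
  \<comment> \<open>\<open>dec\<close> returns some preimage under \<open>g\<close>, which agrees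
    with the original element only modulo \<open>L\<close>.\<close>
  define dec where "dec = inv_into B g"
  have dec: "dec (g x) \<in> B" "g (dec (g x)) = g x" if "x \<in> B" for x
    using that by (auto simp: dec_def inv_into_into f_inv_into_f)
  define M :: "('k, 'm, ('v, 'e, 'k) path_vec) alg_module" where
    "M = \<lparr>carrier = g ` B, mult = (\<lambda>_ _. g 0), one = g 0, zero = g 0,
      add = (\<lambda>m n. g (dec m + dec n)), smult = (\<lambda>k m. g (pa_scale k (dec m))),
      act = (\<lambda>a m. g (pa_mult Q a (dec m)))\<rparr>"
  have carrier: "carrier M = g ` B" and zero: "\<zero>\<^bsub>M\<^esub> = g 0"
    by (simp_all add: M_def)
  have add: "g x \<oplus>\<^bsub>M\<^esub> g y = g (x + y)" if "x \<in> B" "y \<in> B" for x y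
  proof -
    have "(dec (g x) - x) + (dec (g y) - y) \<in> L"
      using that dec g_eq L by (metis left_ideal_def)
    then have "(dec (g x) + dec (g y)) - (x + y) \<in> L" by (simp add: algebra_simps)
    then show ?thesis using that dec by (simp add: M_def g_eq B_closed)
  qed
  have scale: "k \<odot>\<^bsub>M\<^esub> g x = g (pa_scale k x)" if "x \<in> B" for k x
  proof -
    have "pa_scale k (dec (g x) - x) \<in> L"
      using that dec g_eq L by (metis left_ideal_def)
    moreover have "pa_scale k (dec (g x) - x) = pa_scale k (dec (g x)) - pa_scale k x"
      by (rule poly_mapping_eqI) (simp add: lookup_minus right_diff_distrib)
    ultimately show ?thesis using that dec by (simp add: M_def g_eq B_closed)
  qed
  have act: "act M a (g x) = g (pa_mult Q a x)" if "a \<in> path_algebra Q" "x \<in> B" for a x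
  proof -
    have "pa_mult Q a (dec (g x) - x) \<in> L"
      using that dec g_eq L by (metis left_ideal_def)
    moreover have "pa_mult Q a (dec (g x) - x) = pa_mult Q a (dec (g x)) - pa_mult Q a x"
      using pa_mult_add_right[of a "dec (g x) - x" x] by simp
    ultimately show ?thesis using that dec by (simp add: M_def g_eq B_closed)
  qed
  have scale_simps: "pa_scale (k + k') x = pa_scale k x + pa_scale k' x"
    "pa_scale k (x + y) = pa_scale k x + pa_scale k y"
    "pa_scale (k * k') x = pa_scale k (pa_scale k' x)"
    "pa_scale 1 x = x" for k k' :: 'k and x y :: "('v, 'e, 'k) path_vec"
    by (rule poly_mapping_eqI; simp add: lookup_add algebra_simps)+
  note simps = carrier zero add scale act B_closed path_algebra_add path_algebra_scale scale_simps
    pa_mult_closed pa_mult_add_left pa_mult_add_right pa_mult_scale_left pa_mult_scale_right pa_mult_assoc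
  have "abelian_group M"
  proof (rule abelian_groupI)
    fix m assume "m \<in> carrier M"
    then obtain x where x: "x \<in> B" "m = g x" by (auto simp: carrier)
    have "g (0 - x) \<oplus>\<^bsub>M\<^esub> m = g (0 - x + x)"
      using x left_ideal_diff[OF B B_closed(1)] by (simp only: add)
    then show "\<exists>n\<in>carrier M. n \<oplus>\<^bsub>M\<^esub> m = \<zero>\<^bsub>M\<^esub>"
      using x left_ideal_diff[OF B B_closed(1)] by (intro bexI[of _ "g (0 - x)"]) (auto simp: simps)
  qed (auto simp: simps ac_simps)
  then have "Module.module scalar_ring M"
    by (intro moduleI cring_scalar_ring) (auto simp: simps scalar_ring_def)
  then have "path_algebra_module Q M"
    by (intro path_algebra_module.intro path_algebra_module_axioms.intro) (auto simp: simps)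
  moreover have "\<exists>f. pa_idempotent Q f \<and> act M f m = m" if "m \<in> carrier M" for m
  proof -
    obtain x where x: "x \<in> B" "m = g x" using \<open>m \<in> carrier M\<close> by (auto simp: carrier)
    then obtain f where "pa_idempotent Q f" "pa_mult Q f x = x"
      using ex_local_unit B_closed(5) by blast
    then show ?thesis using act[of f x] x by (auto simp: pa_idempotent_def)
  qed
  ultimately have "nondegenerate Q M"
    by (simp add: nondegenerate_def)
  then have "quotient_map M g B L"
    unfolding quotient_map_def using carrier g_eq zero add scale act by blast
  then show ?thesis by blast
qed

section \<open>Left special elements tested on modules\<close>

text \<open>The module \<open>Ae\<close> is generated by \<open>e = ee\<close>, which lies in
  \<open>e(Ae)\<close>, and \<open>B / L\<close> is a subquotient of it annihilated by
  \<open>e\<close>. Left speciality forces \<open>B / L\<close> to be generated by the image of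
  \<open>e\<close>, hence to vanish.\<close>

lemma left_special_ideal_eq:
  fixes e :: "('v, 'e, 'k::{comm_ring, comm_monoid_mult}) path_vec"
    and emb :: "('v, 'e, 'k) path_vec \<Rightarrow> 'm"
  assumes special: "left_special TYPE('m) Q e" and emb: "inj_on emb (path_algebra Q)"
    and B: "left_ideal B" "B \<subseteq> (\<lambda>a. pa_mult Q a e) ` path_algebra Q"
    and L: "left_ideal L" "L \<subseteq> B" and eB: "\<And>y. y \<in> B \<Longrightarrow> pa_mult Q e y \<in> L"
  shows "B = L"
proof -
  let ?P = "(\<lambda>a. pa_mult Q a e) ` path_algebra Q"
  have e: "e \<in> path_algebra Q" "pa_mult Q e e = e"
    using special by (auto simp: left_special_def pa_idempotent_def)
  have P: "left_ideal ?P" by (rule left_ideal_principal[OF e(1)])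
  have zero: "{0} \<subseteq> ?P" "0 \<in> B" and e_P: "e \<in> ?P"
    using P B e by (auto simp: left_ideal_def image_iff intro!: bexI[of _ e])
  obtain M :: "('k, 'm, ('v, 'e, 'k) path_vec) alg_module" and g where "quotient_map M g ?P {0}"
    using ex_quotient_map[OF P left_ideal_zero zero(1) emb] by blast
  note M = quotient_mapD[OF this]
  obtain N :: "('k, 'm, ('v, 'e, 'k) path_vec) alg_module" and h where "quotient_map N h B L"
    using ex_quotient_map[OF B(1) L emb] by blast
  note N = quotient_mapD[OF this]
  interpret M: path_algebra_module Q M
    using M(1) by (simp add: nondegenerate_def)
  interpret N: path_algebra_module Q N
    using N(1) by (simp add: nondegenerate_def)
  have B_closed: "x \<in> B \<Longrightarrow> y \<in> B \<Longrightarrow> x + y \<in> B" "x \<in> B \<Longrightarrow> pa_scale k x \<in> B"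
    "a \<in> path_algebra Q \<Longrightarrow> x \<in> B \<Longrightarrow> pa_mult Q a x \<in> B" for x y a k
    using B(1) by (auto simp: left_ideal_def)
  note B_P = subsetD[OF B(2)]
  have "carrier M \<subseteq> gen_submodule Q e M"
    unfolding gen_submodule_def
  proof (intro Inter_greatest, clarify)
    fix X m assume X: "alg_submodule Q M X" "act M e ` carrier M \<subseteq> X" and "m \<in> carrier M"
    then obtain a where a: "a \<in> path_algebra Q" "m = g (pa_mult Q a e)"
      by (auto simp: M(2))
    have "g e = act M e (g e)"
      using M(7) e e_P by simp
    then have "g e \<in> X"
      using X(2) e_P M(2) by (metis imageI subsetD)
    then show "m \<in> X"
      using X(1) a e_P by (metis M(7) alg_submodule_def)
  qed
  then have M_gen: "carrier M = gen_submodule Q e M"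
    using M.gen_submodule_subset[OF e(1)] by blast
  have "alg_submodule Q M (g ` B)"
    by (rule M.alg_submoduleI) (use B_P B_closed zero in \<open>auto simp: M\<close>)
  \<comment> \<open>As \<open>M\<close> is \<open>Ae\<close> modulo zero, \<open>g\<close> is
    injective, and the projection \<open>h\<close> of \<open>B\<close> onto \<open>B / L\<close> can
    be transported along it.\<close>
  moreover define k where "k = (\<lambda>m. h (inv_into B g m))"
  have "inj_on g B"
    using M(3) B_P by (auto simp: inj_on_def)
  then have k: "k (g x) = h x" if "x \<in> B" for x
    using that by (simp add: k_def)
  ultimately have "subquotient Q N M"
    unfolding subquotient_def
  proof (intro exI[of _ "g ` B"] exI[of _ k] conjI ballI allI)
    show "k ` g ` B = carrier N"
      using k by (force simp: N(2))
    show "k (x \<oplus>\<^bsub>M\<^esub> y) = k x \<oplus>\<^bsub>N\<^esub> k y" if "x \<in> g ` B" "y \<in> g ` B" for x y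
      using that by (auto simp: M(5) N(5) B_P B_closed k)
    show "k (c \<odot>\<^bsub>M\<^esub> x) = c \<odot>\<^bsub>N\<^esub> k x" if "x \<in> g ` B" for c x
      using that by (auto simp: M(6) N(6) B_P B_closed k)
    show "k (act M a x) = act N a (k x)" if "a \<in> path_algebra Q" "x \<in> g ` B" for a x
      using that by (auto simp: M(7) N(7) B_P B_closed k)
  qed
  then have "carrier N = gen_submodule Q e N"
    using special M(1) N(1) M_gen unfolding left_special_def by blast
  \<comment> \<open>Since \<open>e\<close> annihilates \<open>N\<close>, the zero submodule is one
    of those intersected.\<close>
  also have "\<dots> \<subseteq> {\<zero>\<^bsub>N\<^esub>}"
    unfolding gen_submodule_def
  proof (rule Inter_lower, intro CollectI conjI N.alg_submodule_zero image_subsetI)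
    fix m assume "m \<in> carrier N"
    then obtain y where y: "y \<in> B" "m = h y" by (auto simp: N(2))
    then have "h (pa_mult Q e y) = h 0"
      using eB[of y] B_closed e zero by (subst N(3)) auto
    then show "act N e m \<in> {\<zero>\<^bsub>N\<^esub>}"
      using y e by (simp add: N)
  qed
  finally have "h y = h 0" if "y \<in> B" for y
    using that by (auto simp: N(2,4))
  then have "B \<subseteq> L"
    using N(3) zero(2) by (metis diff_zero subsetI)
  then show ?thesis using L by blast
qed

text \<open>The fixed points of \<open>u\<close> in \<open>M\<close> form a submodule by
  \<open>invariant\<close>, and it contains \<open>eM\<close> because \<open>ue = e\<close>; so
  \<open>u\<close> is the identity on \<open>M = AeM\<close>, and then on every subquotient. There
  \<open>eu = u\<close> gives \<open>n = un = e(un)\<close>.\<close>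

lemma left_specialI:
  fixes e u :: "('v, 'e, 'k::{comm_ring, comm_monoid_mult}) path_vec"
  assumes e: "pa_idempotent Q e" and u: "u \<in> path_algebra Q"
    and "pa_mult Q u e = e" "pa_mult Q e u = u"
    and invariant: "\<And>a. a \<in> path_algebra Q \<Longrightarrow> pa_mult Q u (pa_mult Q a u) = pa_mult Q a u"
  shows "left_special TYPE('m) Q e"
  unfolding left_special_def
proof (intro conjI allI impI, fact e, elim conjE)
  fix M N :: "('k, 'm, ('v, 'e, 'k) path_vec) alg_module"
  assume M: "nondegenerate Q M" and M_gen: "carrier M = gen_submodule Q e M"
    and N: "nondegenerate Q N" and "subquotient Q N M"
  interpret M: path_algebra_module Q M
    using M by (simp add: nondegenerate_def)
  interpret N: path_algebra_module Q N
    using N by (simp add: nondegenerate_def)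
  have eA: "e \<in> path_algebra Q" using e by (simp add: pa_idempotent_def)
  let ?X = "{x \<in> carrier M. act M u x = x}"
  have "alg_submodule Q M ?X"
  proof (rule M.alg_submoduleI)
    fix a :: "('v, 'e, 'k) path_vec" and x
    assume a: "a \<in> path_algebra Q" and x: "x \<in> ?X"
    have au: "pa_mult Q a u \<in> path_algebra Q" by (rule pa_mult_closed[OF a u])
    have xM: "x \<in> carrier M" and ux: "act M u x = x" using x by simp_all
    \<comment> \<open>Since \<open>ux = x\<close>, the element \<open>ax\<close> equals
      \<open>(au)x\<close>, to which \<open>invariant\<close> applies.\<close>
    have "act M u (act M (pa_mult Q a u) x) = act M (pa_mult Q a u) x"
      by (simp only: M.act_mult[OF u au xM, symmetric] invariant[OF a])
    then have "act M u (act M a x) = act M a x"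
      by (simp only: M.act_mult[OF a u xM] ux)
    then show "act M a x \<in> ?X"
      using M.act_closed[OF a xM] by simp
  qed (use u M.act_add_right M.act_scale_right in \<open>auto simp: scalar_ring_def intro: M.smult_closed\<close>)
  moreover have "act M e ` carrier M \<subseteq> ?X"
    using assms(3) eA u M.act_closed by (auto simp: M.act_mult[symmetric])
  ultimately have ux: "act M u x = x" if "x \<in> carrier M" for x
    using that M_gen unfolding gen_submodule_def by blast
  obtain L h where L: "alg_submodule Q M L" "h ` L = carrier N"
    "\<forall>a\<in>path_algebra Q. \<forall>x\<in>L. h (act M a x) = act N a (h x)"
    using \<open>subquotient Q N M\<close> unfolding subquotient_def by (elim exE conjE) (rule that)
  have L_M: "L \<subseteq> carrier M"
    using L(1) M.submoduleE(1) by (auto simp: alg_submodule_def)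
  have "n \<in> act N e ` carrier N" if n: "n \<in> carrier N" for n
  proof -
    obtain x where "x \<in> L" "n = h x" using n L(2) by blast
    then have "n = act N u n" using L(3) u ux L_M by (metis subsetD)
    also have "\<dots> = act N e (act N u n)"
      using assms(4) eA u n by (metis N.act_mult)
    finally show ?thesis using N.act_closed[OF u n] by blast
  qed
  then have "carrier N \<subseteq> gen_submodule Q e N"
    unfolding gen_submodule_def by blast
  then show "carrier N = gen_submodule Q e N"
    using N.gen_submodule_subset[OF eA] by blast
qed

section \<open>The coefficient conditions and their sufficiency\<close>

text \<open>With the family of idempotents extended by zero outside \<open>S\<close>, the set
  \<open>S\<close> disappears from the conditions. The second one, at \<open>as = []\<close>,
  expresses idempotence.\<close>

definition special_coeffs :: "('v, 'e, 'k::{comm_ring, comm_monoid_mult}) path_vec \<Rightarrow> bool" where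
  "special_coeffs e \<longleftrightarrow>
    (\<forall>v as. (v, as) \<in> paths Q \<longrightarrow>
      coeff e (v, []) * coeff e (awlast v as, []) = coeff e (v, [])) \<and>
    (\<forall>v as. coeff e (awlast v as, []) * coeff e (v, as) = coeff e (v, as)) \<and>
    (\<forall>v as. as \<noteq> [] \<longrightarrow> coeff e (v, []) * coeff e (v, as) = 0)"

lemma ex_diag_part:
  assumes "e \<in> path_algebra Q"
  shows "\<exists>u\<in>path_algebra Q. diag (\<lambda>v. coeff e (v, [])) u"
proof (rule ex_diag)
  have "{v. coeff e (v, []) \<noteq> 0} \<subseteq> fst ` Poly_Mapping.keys e"
    by (force simp: in_keys_iff)
  then show "finite {v. coeff e (v, []) \<noteq> 0}"
    by (rule finite_subset) simp
  show "{v. coeff e (v, []) \<noteq> 0} \<subseteq> verts Q"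
    using assms unfolding path_algebra_iff by force
qed

lemma left_special_if_special_coeffs:
  fixes e :: "('v, 'e, 'k::{comm_ring, comm_monoid_mult}) path_vec"
  assumes e: "e \<in> path_algebra Q" and coeffs: "special_coeffs e"
  shows "left_special TYPE('m) Q e"
proof -
  define l where "l v = coeff e (v, [])" for v
  have step: "l v * l (awlast v as) = l v" if "(v, as) \<in> paths Q" for v as
    using coeffs that by (simp add: special_coeffs_def l_def)
  have target: "l (awlast v as) * coeff e (v, as) = coeff e (v, as)" for v as
    using coeffs by (simp add: special_coeffs_def l_def)
  have source: "l v * coeff e (v, as) = 0" if "as \<noteq> []" for v as
    using coeffs that by (simp add: special_coeffs_def l_def)
  obtain u where u: "u \<in> path_algebra Q" "diag l u"
    using ex_diag_part[OF e] unfolding l_def by blast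
  note diag_simps = coeff_diag_mult_left[OF u(2)] coeff_diag_mult_right[OF u(2)]
  have ue: "pa_mult Q u e = e"
    by (rule poly_mapping_eqI) (auto simp: diag_simps target)
  have eu: "pa_mult Q e u = u"
  proof (rule poly_mapping_eqI)
    show "coeff (pa_mult Q e u) p = coeff u p" for p
      using u(2) source target[of "fst p" "[]"]
      by (cases p) (auto simp: diag_simps diag_def l_def mult.commute)
  qed
  have "coeff (pa_mult Q e e) (v, as) = coeff e (v, as)" for v as
  proof -
    \<comment> \<open>At a cut before the end, \<open>target\<close> for the first piece inserts the
      factor \<open>l\<close> at the cut vertex. This vertex is the source of the non-trivial second
      piece, so \<open>source\<close> makes the product vanish.\<close>
    have "coeff e (awlast v (take i as), drop i as) * coeff e (v, take i as) =
        (if i = length as then coeff e (v, as) else 0)" if "i \<le> length as" for i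
    proof (cases "i = length as")
      case True
      then show ?thesis using target by (simp add: l_def)
    next
      case False
      then have "coeff e (awlast v (take i as), drop i as) * (l (awlast v (take i as)) * coeff e (v, take i as)) = 0"
        using that source[of "drop i as" "awlast v (take i as)"]
        by (metis (no_types, lifting) drop_eq_Nil2 le_antisym mult.assoc mult.commute mult_zero_left)
      then show ?thesis using False by (simp add: target)
    qed
    then show ?thesis by (simp add: coeff_pa_mult)
  qed
  then have "pa_idempotent Q e"
    using e by (auto simp: pa_idempotent_def intro!: poly_mapping_eqI)
  moreover have "pa_mult Q u (pa_mult Q a u) = pa_mult Q a u" if "a \<in> path_algebra Q" for a
  proof (rule poly_mapping_eqI)
    fix p :: "('v, 'e) path"
    obtain v as where p: "p = (v, as)" by (cases p)
    show "coeff (pa_mult Q u (pa_mult Q a u)) p = coeff (pa_mult Q a u) p"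
    proof (cases "p \<in> paths Q")
      case True
      then show ?thesis
        using step[of v as] by (simp add: p diag_simps) (metis mult.commute mult.left_commute)
    next
      case False
      then show ?thesis using that by (simp add: p diag_simps path_algebra_iff)
    qed
  qed
  ultimately show ?thesis
    using left_specialI[OF _ u(1) ue eu] by blast
qed

section \<open>Necessity of the coefficient conditions\<close>

text \<open>In \<open>ee = e\<close> at \<open>(v, as)\<close>, the cut at the end already yields
  the right-hand side, so the other cuts sum to zero. Multiplied by \<open>coeff e (v, [])\<close>,
  the inner cuts vanish by induction, and the cut at 0 leaves the claim.\<close>

lemma coeff_mult_trivial_source:
  assumes idem: "pa_mult Q e e = e"
    and target: "\<And>v as. coeff e (awlast v as, []) * coeff e (v, as) = coeff e (v, as)"
    and "as \<noteq> []"
  shows "coeff e (v, []) * coeff e (v, as) = 0"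
  using \<open>as \<noteq> []\<close>
proof (induction "length as" arbitrary: as rule: less_induct)
  case less
  let ?f = "\<lambda>i. coeff e (awlast v (take i as), drop i as) * coeff e (v, take i as)"
  have "(\<Sum>i<length as. ?f i) + coeff e (v, as) = coeff e (v, as)"
    using arg_cong[OF idem, of "\<lambda>a. coeff a (v, as)"] target
    by (simp add: coeff_pa_mult lessThan_Suc_atMost[symmetric])
  then have "(\<Sum>i<length as. ?f i) = 0" by simp
  then have "0 = (\<Sum>i<length as. coeff e (v, []) * ?f i)"
    by (simp add: sum_distrib_left[symmetric])
  also have "\<dots> = (\<Sum>i<length as. if i = 0 then coeff e (v, []) * coeff e (v, as) else 0)"
  proof (rule sum.cong[OF refl])
    fix i assume i: "i \<in> {..<length as}"
    show "coeff e (v, []) * ?f i = (if i = 0 then coeff e (v, []) * coeff e (v, as) else 0)"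
    proof (cases "i = 0")
      case True
      then show ?thesis using target[of v "[]"] by simp (metis mult.assoc mult.commute)
    next
      case False
      then have "coeff e (v, []) * coeff e (v, take i as) = 0"
        using less i by auto
      then show ?thesis using False by simp (metis mult.left_commute mult_zero_right)
    qed
  qed
  finally show ?case using less.prems by simp
qed

text \<open>Left multiplication only extends paths at their end, so it never lowers the
  degree.\<close>

lemma left_ideal_long_paths:
  fixes B :: "('v, 'e, 'k::{comm_ring, comm_monoid_mult}) path_vec set"
  assumes "left_ideal B"
  shows "left_ideal {y \<in> B. \<forall>v as. length as < m \<longrightarrow> coeff y (v, as) = 0}"
  using assms by (auto simp: left_ideal_def lookup_add coeff_pa_mult intro!: sum.neutral)

text \<open>At any cut before the end, the piece assigned to \<open>y\<close> is shorter than
  \<open>m\<close>.\<close>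

lemma coeff_pa_mult_leading:
  fixes a y :: "('v, 'e, 'k::{comm_ring, comm_monoid_mult}) path_vec"
  assumes "\<And>v as. length as < m \<Longrightarrow> coeff y (v, as) = 0" and "length as = m"
  shows "coeff (pa_mult Q a y) (v, as) = coeff a (awlast v as, []) * coeff y (v, as)"
proof -
  have "coeff (pa_mult Q a y) (v, as) =
      (\<Sum>i\<le>m. if i = m then coeff a (awlast v as, []) * coeff y (v, as) else 0)"
    unfolding coeff_pa_mult using assms by (intro sum.cong) auto
  then show ?thesis by simp
qed

text \<open>Left multiplication by \<^term>\<open>e\<close> acts on the lowest-degree coefficients of the elements of
  the submodule in degrees \<open>\<ge> m\<close> through its degree-zero part, so that the lowest-degree
  coefficients fixed by this part define a submodule, with a quotient on which \<^term>\<open>e\<close>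
  vanishes.\<close>

lemma left_special_leading_coeff:
  fixes e :: "('v, 'e, 'k::{comm_ring, comm_monoid_mult}) path_vec"
    and emb :: "('v, 'e, 'k) path_vec \<Rightarrow> 'm"
  assumes special: "left_special TYPE('m) Q e" and emb: "inj_on emb (path_algebra Q)"
    and a: "a \<in> path_algebra Q"
    and "\<And>v as. length as < m \<Longrightarrow> coeff (pa_mult Q a e) (v, as) = 0" and "length as = m"
  shows "coeff e (awlast v as, []) * coeff (pa_mult Q a e) (v, as) = coeff (pa_mult Q a e) (v, as)"
proof -
  have e: "e \<in> path_algebra Q" "pa_mult Q e e = e"
    using special by (auto simp: left_special_def pa_idempotent_def)
  have idem: "coeff e (v, []) * coeff e (v, []) = coeff e (v, [])" for v
    using arg_cong[OF e(2), of "\<lambda>a. coeff a (v, [])"] by (simp add: coeff_pa_mult)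
  let ?P = "(\<lambda>a. pa_mult Q a e) ` path_algebra Q"
  let ?B = "{y \<in> ?P. \<forall>v as. length as < m \<longrightarrow> coeff y (v, as) = 0}"
  let ?L = "{y \<in> ?B. \<forall>v as. length as = m \<longrightarrow>
    coeff e (awlast v as, []) * coeff y (v, as) = coeff y (v, as)}"
  have B: "left_ideal ?B"
    by (intro left_ideal_long_paths left_ideal_principal e)
  have leading: "coeff (pa_mult Q a y) (v, as) = coeff a (awlast v as, []) * coeff y (v, as)"
    if "y \<in> ?B" "length as = m" for a y v as
    using that by (intro coeff_pa_mult_leading) auto
  have L: "left_ideal ?L"
    unfolding left_ideal_def
  proof (intro conjI ballI allI)
    show "?L \<subseteq> path_algebra Q" "0 \<in> ?L"
      using B by (auto simp: left_ideal_def)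
    show "x + y \<in> ?L" if "x \<in> ?L" "y \<in> ?L" for x y
    proof -
      have "x + y \<in> ?B" using that B unfolding left_ideal_def by blast
      then show ?thesis using that by (simp add: lookup_add distrib_left)
    qed
    show "pa_scale k x \<in> ?L" if "x \<in> ?L" for k x
    proof -
      have "pa_scale k x \<in> ?B" using that B unfolding left_ideal_def by blast
      then show ?thesis using that by (simp add: mult.left_commute)
    qed
    show "pa_mult Q b x \<in> ?L" if "b \<in> path_algebra Q" "x \<in> ?L" for b x
    proof -
      have x: "x \<in> ?B" using that by blast
      then have "pa_mult Q b x \<in> ?B" using that B unfolding left_ideal_def by blast
      then show ?thesis using that leading[OF x] by (simp add: mult.left_commute)
    qed
  qed
  have "?B = ?L"
  proof (rule left_special_ideal_eq[OF special emb B _ L])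
    \<comment> \<open>In degree \<open>m\<close>, multiplication by \<open>e\<close> multiplies each
      coefficient of \<open>y\<close> by the idempotent at its target, and a second multiplication
      by it changes nothing.\<close>
    show "pa_mult Q e y \<in> ?L" if y: "y \<in> ?B" for y
    proof -
      have "pa_mult Q e y \<in> ?B" using y B e unfolding left_ideal_def by blast
      then show ?thesis using leading[OF y] by (simp add: mult.assoc[symmetric] idem)
    qed
  qed auto
  moreover have "pa_mult Q a e \<in> ?B"
    using assms by auto
  ultimately have "pa_mult Q a e \<in> ?L" by (rule subst)
  then show ?thesis using \<open>length as = m\<close> by blast
qed

lemma special_coeffs_if_left_special:
  fixes e :: "('v, 'e, 'k::{comm_ring, comm_monoid_mult}) path_vec"
    and emb :: "('v, 'e, 'k) path_vec \<Rightarrow> 'm"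
  assumes special: "left_special TYPE('m) Q e" and emb: "inj_on emb (path_algebra Q)"
  shows "special_coeffs e"
proof -
  note leading = left_special_leading_coeff[OF special emb]
  have e: "e \<in> path_algebra Q" "pa_mult Q e e = e"
    using special by (auto simp: left_special_def pa_idempotent_def)
  obtain u where u: "u \<in> path_algebra Q" "diag (\<lambda>v. coeff e (v, [])) u"
    using ex_diag_part[OF e(1)] by blast
  have target: "coeff e (awlast v as, []) * coeff e (v, as) = coeff e (v, as)" for v as
  proof (induction "length as" arbitrary: v as rule: less_induct)
    case less
    have *: "pa_mult Q (u - e) e = pa_mult Q u e - e"
      using pa_mult_add_left[of "u - e" e e] e by (simp add: algebra_simps)
    have diff: "coeff (pa_mult Q (u - e) e) (w, bs) =
        coeff e (awlast w bs, []) * coeff e (w, bs) - coeff e (w, bs)" for w bs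
      by (simp add: * lookup_minus coeff_diag_mult_left[OF u(2)])
    have "u - e \<in> path_algebra Q"
      using u(1) e(1) by (simp add: path_algebra_iff lookup_minus)
    \<comment> \<open>By induction \<open>(u - e)e\<close> vanishes on paths shorter than
      \<open>as\<close>. Its coefficient at \<open>as\<close> is therefore fixed by the idempotent
      at the target, which also annihilates it.\<close>
    then have "coeff e (awlast v as, []) * coeff (pa_mult Q (u - e) e) (v, as) =
        coeff (pa_mult Q (u - e) e) (v, as)"
      by (rule leading[OF _ _ refl]) (simp add: diff less)
    moreover have "coeff e (w, []) * coeff e (w, []) = coeff e (w, [])" for w
      using arg_cong[OF e(2), of "\<lambda>a. coeff a (w, [])"] by (simp add: coeff_pa_mult)
    ultimately show ?case
      by (simp add: diff right_diff_distrib mult.assoc[symmetric])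
  qed
  have step: "coeff e (v, []) * coeff e (awlast v as, []) = coeff e (v, [])"
    if "(v, as) \<in> paths Q" for v as
  proof -
    \<comment> \<open>All paths in \<open>qe\<close> extend \<open>as\<close> at its start, so none
      is shorter than \<open>as\<close>; the coefficient at \<open>(v, as)\<close> itself is that of
      \<open>e\<close> at the source \<open>v\<close>.\<close>
    define q :: "('v, 'e, 'k) path_vec" where "q = Poly_Mapping.single (v, as) 1"
    have q: "q \<in> path_algebra Q"
      using that by (auto simp: q_def path_algebra_iff lookup_single when_def)
    have "coeff (pa_mult Q q e) (w, bs) = 0" if "length bs < length as" for w bs
      unfolding coeff_pa_mult q_def using that by (intro sum.neutral) (auto simp: lookup_single when_def)
    moreover have "coeff (pa_mult Q q e) (v, as) = (\<Sum>i\<le>length as. if i = 0 then coeff e (v, []) else 0)"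
    proof -
      \<comment> \<open>Only the cut at 0 leaves all of \<open>as\<close> as the second
        piece.\<close>
      have "as \<noteq> drop i as" if "i \<le> length as" "i \<noteq> 0" for i
      proof -
        have "length (drop i as) < length as" using that by simp
        then show ?thesis by (metis less_irrefl)
      qed
      then show ?thesis
        unfolding coeff_pa_mult q_def by (intro sum.cong) (auto simp: lookup_single when_def)
    qed
    ultimately show ?thesis
      using leading[OF q, of "length as" as v] by (simp add: mult.commute)
  qed
  show ?thesis
    using step target coeff_mult_trivial_source[OF e(2) target] by (simp add: special_coeffs_def)
qed

end

section \<open>Translation between the coefficient conditions and the explicit form\<close>

theorem proposition4p5:
  fixes Q :: "('v, 'e) pre_digraph"
    and e :: "('v, 'e, 'k::{comm_ring, comm_monoid_mult}) path_vec"
    and emb :: "('v, 'e, 'k) path_vec list \<Rightarrow> 'm"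
  assumes "wf_digraph Q"
    and "e \<in> path_algebra Q"
    and large_universe: "inj_on emb (lists (path_algebra Q))"
  shows "left_special TYPE('m) Q e \<longleftrightarrow>
    (\<exists>(S :: 'v set) (l :: 'v \<Rightarrow> 'k) (n :: nat) (p :: nat \<Rightarrow> ('v, 'e) path) (\<kappa> :: nat \<Rightarrow> 'k).
      left_closed Q S \<and>
      (\<forall>v\<in>S. l v \<noteq> 0 \<and> l v * l v = l v) \<and>
      (\<forall>q\<in>paths Q. path_source q \<in> S \<longrightarrow>
        range (\<lambda>k. k * l (path_source q)) \<subseteq> range (\<lambda>k. k * l (path_target Q q))) \<and>
      (\<forall>i\<in>{1..n}. p i \<in> paths Q) \<and> inj_on p {1..n} \<and>
      (\<forall>i\<in>{1..n}. path_target Q (p i) \<in> S) \<and>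
      (\<forall>i\<in>{1..n}. \<kappa> i \<noteq> 0 \<and> l (path_target Q (p i)) * \<kappa> i = \<kappa> i) \<and>
      (\<forall>i\<in>{1..n}. path_source (p i) \<in> S \<longrightarrow> l (path_source (p i)) * \<kappa> i = 0) \<and>
      e = (\<Sum>v\<in>S. Poly_Mapping.single (trivial_path v) (l v)) +
          (\<Sum>i = 1..n. Poly_Mapping.single (p i) (\<kappa> i)))"
    (is "_ \<longleftrightarrow> ?explicit")
proof -
  interpret quiver Q
    using assms(1) by (rule quiver.intro)
  \<comment> \<open>One-element sequences embed the algebra itself into the universe.\<close>
  have "inj_on (\<lambda>x. emb [x]) (path_algebra Q)"
    by (rule inj_onI) (use inj_onD[OF large_universe, of "[_]" "[_]"] in auto)
  then have "left_special TYPE('m) Q e \<longleftrightarrow> special_coeffs e"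
    using special_coeffs_if_left_special left_special_if_special_coeffs[OF assms(2)] by blast
  also have "\<dots> \<longleftrightarrow> ?explicit"
  proof
    assume coeffs: "special_coeffs e"
    define l where "l v = coeff e (v, [])" for v
    define S where "S = {v. l v \<noteq> 0}"
    \<comment> \<open>The non-trivial paths in the support of \<open>e\<close>; an enumeration of
      them supplies the \<open>p i\<close>.\<close>
    define K where "K = {q \<in> Poly_Mapping.keys e. snd q \<noteq> []}"
    have step: "l v * l (awlast v as) = l v" if "(v, as) \<in> paths Q" for v as
      using coeffs that by (simp add: special_coeffs_def l_def)
    have target: "l (awlast v as) * coeff e (v, as) = coeff e (v, as)" for v as
      using coeffs by (simp add: special_coeffs_def l_def)
    have source: "l v * coeff e (v, as) = 0" if "as \<noteq> []" for v as
      using coeffs that by (simp add: special_coeffs_def l_def)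
    have "finite K" by (simp add: K_def)
    then obtain p where p: "bij_betw p {1..card K} K"
      using ex_bij_betw_nat_finite_1 by blast
    have S_verts: "S \<subseteq> verts Q"
      using assms(2) unfolding S_def l_def path_algebra_iff by force
    have "S \<subseteq> fst ` Poly_Mapping.keys e"
      by (force simp: S_def l_def in_keys_iff)
    then have "finite S" by (rule finite_subset) simp
    moreover have "head Q a \<in> S" if "a \<in> arcs Q" "tail Q a \<in> S" for a
    proof -
      have "(tail Q a, [a]) \<in> paths Q"
        using arc_implies_awalk[OF that(1)] by (auto simp: paths_def)
      then show ?thesis using step[of "tail Q a" "[a]"] that by (auto simp: S_def)
    qed
    ultimately have "left_closed Q S"
      using S_verts by (simp add: left_closed_def)
    moreover have "\<forall>v\<in>S. l v \<noteq> 0 \<and> l v * l v = l v"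
      using target[of _ "[]"] by (auto simp: S_def l_def)
    moreover have "range (\<lambda>k. k * l (path_source q)) \<subseteq> range (\<lambda>k. k * l (path_target Q q))"
      if "q \<in> paths Q" for q
    proof (rule image_subsetI)
      fix k
      have "k * l (path_source q) = k * l (path_source q) * l (path_target Q q)"
        using step[of "fst q" "snd q"] that
        by (simp add: path_source_def path_target_def mult.assoc)
      then show "k * l (path_source q) \<in> range (\<lambda>k. k * l (path_target Q q))"
        by blast
    qed
    moreover have p_K: "p i \<in> K" if "i \<in> {1..card K}" for i
      using p that by (auto simp: bij_betw_def)
    have K: "q \<in> paths Q \<and> path_target Q q \<in> S \<and> coeff e q \<noteq> 0 \<and>
        l (path_target Q q) * coeff e q = coeff e q \<and> l (path_source q) * coeff e q = 0"
      if "q \<in> K" for q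
    proof -
      obtain v as where q: "q = (v, as)" by (cases q)
      have "coeff e q \<noteq> 0" "as \<noteq> []" using that by (auto simp: K_def q in_keys_iff)
      \<comment> \<open>Otherwise \<open>target\<close> would make the coefficient at
        \<open>q\<close> zero.\<close>
      moreover from this have "l (awlast v as) \<noteq> 0" using target[of v as] q by auto
      ultimately show ?thesis
        using assms(2) target[of v as] source[of as v]
        by (auto simp: q S_def path_algebra_iff path_target_def path_source_def)
    qed
    moreover have "inj_on p {1..card K}"
      using p by (simp add: bij_betw_def)
    moreover have "e = (\<Sum>v\<in>S. Poly_Mapping.single (trivial_path v) (l v)) +
        (\<Sum>i = 1..card K. Poly_Mapping.single (p i) (coeff e (p i)))"
    proof (rule poly_mapping_eqI)
      fix q :: "('v, 'e) path"
      obtain v as where q: "q = (v, as)" by (cases q)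
      have "(\<Sum>i = 1..card K. Poly_Mapping.single (p i) (coeff e (p i))) =
          (\<Sum>q\<in>K. Poly_Mapping.single q (coeff e q))"
        by (rule sum.reindex_bij_betw[OF p])
      then have "coeff (\<Sum>i = 1..card K. Poly_Mapping.single (p i) (coeff e (p i))) q =
          (if q \<in> K then coeff e q else 0)"
        using \<open>finite K\<close> by (simp add: lookup_sum lookup_single when_def)
      moreover have "coeff (\<Sum>v\<in>S. Poly_Mapping.single (trivial_path v) (l v)) q =
          (\<Sum>w\<in>S. if w = v then (if as = [] then l v else 0) else 0)"
        unfolding lookup_sum by (intro sum.cong) (auto simp: q trivial_path_def lookup_single when_def)
      ultimately show "coeff e q = coeff ((\<Sum>v\<in>S. Poly_Mapping.single (trivial_path v) (l v)) +
          (\<Sum>i = 1..card K. Poly_Mapping.single (p i) (coeff e (p i)))) q"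
        using \<open>finite S\<close> by (auto simp: lookup_add q K_def S_def l_def in_keys_iff)
    qed
    ultimately show ?explicit
      using p_K K
      by (intro exI[of _ S] exI[of _ l] exI[of _ "card K"] exI[of _ p] exI[of _ "\<lambda>i. coeff e (p i)"])
        (intro conjI ballI impI; blast)
  next
    assume ?explicit
    then obtain S l p \<kappa> and n :: nat where S: "left_closed Q S"
      and l: "\<forall>v\<in>S. l v \<noteq> 0 \<and> l v * l v = l v"
      and range: "\<forall>q\<in>paths Q. path_source q \<in> S \<longrightarrow>
        range (\<lambda>k. k * l (path_source q)) \<subseteq> range (\<lambda>k. k * l (path_target Q q))"
      and p: "inj_on p {1..n}" "\<forall>i\<in>{1..n}. path_target Q (p i) \<in> S"
      and \<kappa>: "\<forall>i\<in>{1..n}. \<kappa> i \<noteq> 0 \<and> l (path_target Q (p i)) * \<kappa> i = \<kappa> i"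
        "\<forall>i\<in>{1..n}. path_source (p i) \<in> S \<longrightarrow> l (path_source (p i)) * \<kappa> i = 0"
      and e: "e = (\<Sum>v\<in>S. Poly_Mapping.single (trivial_path v) (l v)) +
          (\<Sum>i = 1..n. Poly_Mapping.single (p i) (\<kappa> i))"
      by (elim exE conjE) (rule that)
    have "finite S" using S by (simp add: left_closed_def)
    \<comment> \<open>For a trivial \<open>p i\<close> the source is the target and lies in
      \<open>S\<close>, so the two conditions in \<kappa> would give \<open>\<kappa> i = 0\<close>.
      Hence the two sums in \<open>e\<close> have no path in common.\<close>
    have p_nontrivial: "snd (p i) \<noteq> []" if "i \<in> {1..n}" for i
    proof
      assume "snd (p i) = []"
      then have "path_target Q (p i) = path_source (p i)"
        by (simp add: path_target_def path_source_def)
      then show False using p(2) \<kappa> that by metis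
    qed
    have coeff_e: "coeff e (v, as) = (if as = [] \<and> v \<in> S then l v else 0) +
        (\<Sum>i = 1..n. if p i = (v, as) then \<kappa> i else 0)" for v as
    proof -
      have "coeff (\<Sum>v\<in>S. Poly_Mapping.single (trivial_path v) (l v)) (v, as) =
          (\<Sum>w\<in>S. if w = v then (if as = [] then l v else 0) else 0)"
        unfolding lookup_sum by (intro sum.cong) (auto simp: trivial_path_def lookup_single when_def)
      moreover have "coeff (\<Sum>i = 1..n. Poly_Mapping.single (p i) (\<kappa> i)) (v, as) =
          (\<Sum>i = 1..n. if p i = (v, as) then \<kappa> i else 0)"
        unfolding lookup_sum by (intro sum.cong) (auto simp: lookup_single when_def)
      ultimately show ?thesis
        using \<open>finite S\<close> by (simp add: e lookup_add)
    qed
    have trivial: "coeff e (v, []) = (if v \<in> S then l v else 0)" for v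
    proof -
      have "(\<Sum>i = 1..n. if p i = (v, []) then \<kappa> i else 0) = 0"
        by (rule sum.neutral) (use p_nontrivial in force)
      then show ?thesis by (simp add: coeff_e)
    qed
    \<comment> \<open>The paths \<open>p i\<close> are distinct, so at most one summand
      contributes.\<close>
    have nontrivial: "coeff e (v, as) = 0 \<or> (\<exists>i\<in>{1..n}. p i = (v, as) \<and> coeff e (v, as) = \<kappa> i)"
      if "as \<noteq> []" for v as
    proof (cases "\<exists>i\<in>{1..n}. p i = (v, as)")
      case True
      then obtain i where i: "i \<in> {1..n}" "p i = (v, as)" by blast
      have "p j = (v, as) \<longleftrightarrow> j = i" if "j \<in> {1..n}" for j
        using i that inj_onD[OF p(1)] by metis
      then have "(\<Sum>j = 1..n. if p j = (v, as) then \<kappa> j else 0) = (\<Sum>j = 1..n. if j = i then \<kappa> i else 0)"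
        by (intro sum.cong) simp_all
      then show ?thesis using i that by (auto simp: coeff_e)
    next
      case False
      then have "(\<Sum>j = 1..n. if p j = (v, as) then \<kappa> j else 0) = 0"
        by (intro sum.neutral) auto
      then show ?thesis using that by (simp add: coeff_e)
    qed
    have closed: "awlast v as \<in> S" if "(v, as) \<in> paths Q" "v \<in> S" for v as
      using that
    proof (induction as arbitrary: v)
      case (Cons a as)
      then have "a \<in> arcs Q" "tail Q a = v" "(head Q a, as) \<in> paths Q"
        by (auto simp: paths_iff awalk_Cons_iff)
      then show ?case using Cons S by (auto simp: left_closed_def)
    qed simp
    have "coeff e (v, []) * coeff e (awlast v as, []) = coeff e (v, [])" if "(v, as) \<in> paths Q" for v as
    proof (cases "v \<in> S")
      case True
      then have "awlast v as \<in> S" using closed that by blast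
      \<comment> \<open>The inclusion of ideals is used for the generator \<open>l v\<close>: it is
        a multiple of the idempotent \<open>l (awlast v as)\<close> and is therefore fixed by
        it.\<close>
      have "1 * l v \<in> range (\<lambda>k. k * l (awlast v as))"
        using bspec[OF range that] True
        unfolding path_source_def path_target_def fst_conv snd_conv by blast
      then obtain k where "l v = k * l (awlast v as)" by auto
      then have "l v * l (awlast v as) = l v"
        using l \<open>awlast v as \<in> S\<close> by (simp add: mult.assoc)
      then show ?thesis using True \<open>awlast v as \<in> S\<close> by (simp add: trivial)
    qed (simp add: trivial)
    moreover have "coeff e (awlast v as, []) * coeff e (v, as) = coeff e (v, as)" for v as
    proof (cases "as = []")
      case True
      then show ?thesis using l by (simp add: trivial)
    next
      case False
      then show ?thesis
        using nontrivial[OF False, of v] p(2) \<kappa>(1) by (auto simp: trivial path_target_def)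
    qed
    moreover have "coeff e (v, []) * coeff e (v, as) = 0" if "as \<noteq> []" for v as
      using nontrivial[OF that, of v] \<kappa>(2) by (auto simp: trivial path_source_def)
    ultimately show "special_coeffs e" by (simp add: special_coeffs_def)
  qed
  finally show ?thesis .
qed

end
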